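(* Let $A\in\mathbb{Q}_s^{m\times n}$, set $M=A^\sigma\in\mathbb{R}^{2m\times2n}$, and suppose $M\neq0$. Let $$0<\alpha<\frac{2}{\|M\|_2^2},$$ let $X_k\in\mathbb{R}^{2n\times2m}$ be generated by $X_0=\alpha M^T$, $X_{k+1}=X_k(2I_{2m}-MX_k)=(2I_{2n}-X_kM)X_k$, and set $\widehat X_k:=\sigma^{-1}(X_k)$. Then $\widehat X_k\to A^\dagger$. If $\widehat E_k:=\widehat X_k-A^\dagger$, then $$\|\widehat E_{k+1}\|_F\leq\sqrt2\,\|A\|_{\sigma,2}\,\|\widehat E_k\|_F^2 .$$
   Context: $\mathbb{Q}_s$ is the real algebra of split quaternions $q=q_1+q_2\mathbf{i}+q_3\mathbf{j}+q_4\mathbf{k}$ ($q_\ell\in\mathbb{R}$) with $\mathbf{i}^2=-1$, $\mathbf{j}^2=\mathbf{k}^2=1$, $\mathbf{i}\mathbf{j}=\mathbf{k}=-\mathbf{j}\mathbf{i}$, $\mathbf{j}\mathbf{k}=-\mathbf{i}=-\mathbf{k}\mathbf{j}$, $\mathbf{k}\mathbf{i}=\mathbf{j}=-\mathbf{i}\mathbf{k}$. A matrix $A\in\mathbb{Q}_s^{m\times n}$ is written $A=A_1+A_2\mathbf{i}+A_3\mathbf{j}+A_4\mathbf{k}$ with $A_\ell\in\mathbb{R}^{m\times n}$. Its real representation is $$A^\sigma=\begin{bmatrix} A_1+A_3 & -A_2+A_4 \\ A_2+A_4 & A_1-A_3 \end{bmatrix}\in\mathbb{R}^{2m\times 2n};$$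 the map $\sigma: A\mapsto A^\sigma$ is a bijection $\mathbb{Q}_s^{m\times n}\to\mathbb{R}^{2m\times 2n}$ with inverse $\sigma^{-1}$ (for all sizes). For a real matrix $M$, $M^\dagger$ is the usual real Moore--Penrose inverse; for $A\in\mathbb{Q}_s^{m\times n}$, $A^\dagger:=\sigma^{-1}((A^\sigma)^\dagger)\in\mathbb{Q}_s^{n\times m}$. Norms: $\|A\|_F^2:=\sum_{\ell=1}^4\|A_\ell\|_F^2$ for split-quaternion $A$ (convergence is in this norm), $\|\cdot\|_2$ is the spectral norm of real matrices, and $\|A\|_{\sigma,2}:=\|A^\sigma\|_2$. *)

theory Defs
  imports "HOL-Analysis.Analysis"
begin

text \<open>\<open>SQ a b c d\<close> is $a + b\mathbf{i} + c\mathbf{j} + d\mathbf{k}$.\<close>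

datatype split_quat = SQ (sq1: real) (sq2: real) (sq3: real) (sq4: real)

lemma split_quat_eq_iff:
  "p = q \<longleftrightarrow> sq1 p = sq1 q \<and> sq2 p = sq2 q \<and> sq3 p = sq3 q \<and> sq4 p = sq4 q"
  using split_quat.expand by auto

instantiation split_quat :: ring_1
begin

definition "0 = SQ 0 0 0 0"
definition "1 = SQ 1 0 0 0"
definition "p + q = SQ (sq1 p + sq1 q) (sq2 p + sq2 q) (sq3 p + sq3 q) (sq4 p + sq4 q)"
definition "- p = SQ (- sq1 p) (- sq2 p) (- sq3 p) (- sq4 p)"
definition "p - q = SQ (sq1 p - sq1 q) (sq2 p - sq2 q) (sq3 p - sq3 q) (sq4 p - sq4 q)"
definition "p * q = SQ
  (sq1 p * sq1 q - sq2 p * sq2 q + sq3 p * sq3 q + sq4 p * sq4 q)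
  (sq1 p * sq2 q + sq2 p * sq1 q - sq3 p * sq4 q + sq4 p * sq3 q)
  (sq1 p * sq3 q + sq3 p * sq1 q + sq4 p * sq2 q - sq2 p * sq4 q)
  (sq1 p * sq4 q + sq4 p * sq1 q + sq2 p * sq3 q - sq3 p * sq2 q)"

lemmas split_quat_defs = zero_split_quat_def one_split_quat_def plus_split_quat_def
  uminus_split_quat_def minus_split_quat_def times_split_quat_def

instance
  by standard (simp_all add: split_quat_defs split_quat_eq_iff algebra_simps)

end

instantiation split_quat :: real_algebra_1
begin

definition "r *\<^sub>R q = SQ (r * sq1 q) (r * sq2 q) (r * sq3 q) (r * sq4 q)"

instance
  by standard (simp_all add: split_quat_defs scaleR_split_quat_def split_quat_eq_iff algebra_simps)

end

definition "sq_i = SQ 0 1 0 0"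
definition "sq_j = SQ 0 0 1 0"
definition "sq_k = SQ 0 0 0 1"

lemma sq_expand:
  "q = sq1 q *\<^sub>R 1 + sq2 q *\<^sub>R sq_i + sq3 q *\<^sub>R sq_j + sq4 q *\<^sub>R sq_k"
  by (simp add: split_quat_defs scaleR_split_quat_def sq_i_def sq_j_def sq_k_def split_quat_eq_iff)

lemma sq_unit_mult:
  "sq_i * sq_i = - 1" "sq_j * sq_j = 1" "sq_k * sq_k = 1"
  "sq_i * sq_j = sq_k" "sq_j * sq_i = - sq_k"
  "sq_j * sq_k = - sq_i" "sq_k * sq_j = sq_i"
  "sq_k * sq_i = sq_j" "sq_i * sq_k = - sq_j"
  by (simp_all add: split_quat_defs sq_i_def sq_j_def sq_k_def)

text \<open>The Euclidean structure of $\mathbb{R}^4$.  Its only purpose is that the library norm and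
  topology on \<open>split_quat ^ 'n ^ 'm\<close> become those of the Frobenius norm (see \<open>fro_norm_eq_norm\<close>).\<close>

instantiation split_quat :: real_inner
begin

definition inner_split_quat :: "split_quat \<Rightarrow> split_quat \<Rightarrow> real" where
  "inner_split_quat p q = sq1 p * sq1 q + sq2 p * sq2 q + sq3 p * sq3 q + sq4 p * sq4 q"
definition norm_split_quat :: "split_quat \<Rightarrow> real" where
  "norm_split_quat q = sqrt (inner q q)"
definition sgn_split_quat :: "split_quat \<Rightarrow> split_quat" where
  "sgn_split_quat q = q /\<^sub>R norm q"
definition dist_split_quat :: "split_quat \<Rightarrow> split_quat \<Rightarrow> real" where
  "dist_split_quat p q = norm (p - q)"
definition uniformity_split_quat :: "(split_quat \<times> split_quat) filter" where
  "uniformity_split_quat = (INF e\<in>{0 <..}. principal {(p, q). dist p q < e})"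
definition open_split_quat :: "split_quat set \<Rightarrow> bool" where
  "open_split_quat U \<longleftrightarrow> (\<forall>p\<in>U. eventually (\<lambda>(p', q). p' = p \<longrightarrow> q \<in> U) uniformity)"

instance
proof
  fix p q r :: split_quat and a :: real
  show "inner p q = inner q p"
    by (simp add: inner_split_quat_def mult.commute)
  show "inner (p + q) r = inner p r + inner q r" "inner (a *\<^sub>R p) q = a * inner p q"
    by (simp_all add: inner_split_quat_def split_quat_defs scaleR_split_quat_def algebra_simps)
  show "0 \<le> inner p p"
    by (simp add: inner_split_quat_def)
  show "inner p p = 0 \<longleftrightarrow> p = 0"
    by (simp add: inner_split_quat_def split_quat_defs split_quat_eq_iff
        add_nonneg_eq_0_iff)
qed (simp_all add: norm_split_quat_def sgn_split_quat_def dist_split_quat_def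
      uniformity_split_quat_def open_split_quat_def)

end

text \<open>An $m \times n$ matrix has type \<open>split_quat ^ 'n ^ 'm\<close>; a real $2m \times 2n$ matrix has type
  \<open>real ^ ('n + 'n) ^ ('m + 'm)\<close>, where \<open>Inl\<close> indexes the first and \<open>Inr\<close> the second block.\<close>

definition mat1 :: "split_quat ^ 'n ^ 'm \<Rightarrow> real ^ 'n ^ 'm" where
  "mat1 A = (\<chi> i j. sq1 (A $ i $ j))"
definition mat2 :: "split_quat ^ 'n ^ 'm \<Rightarrow> real ^ 'n ^ 'm" where
  "mat2 A = (\<chi> i j. sq2 (A $ i $ j))"
definition mat3 :: "split_quat ^ 'n ^ 'm \<Rightarrow> real ^ 'n ^ 'm" where
  "mat3 A = (\<chi> i j. sq3 (A $ i $ j))"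
definition mat4 :: "split_quat ^ 'n ^ 'm \<Rightarrow> real ^ 'n ^ 'm" where
  "mat4 A = (\<chi> i j. sq4 (A $ i $ j))"

definition block2 ::
  "real ^ 'n ^ 'm \<Rightarrow> real ^ 'n ^ 'm \<Rightarrow> real ^ 'n ^ 'm \<Rightarrow> real ^ 'n ^ 'm
    \<Rightarrow> real ^ ('n + 'n) ^ ('m + 'm)" where
  "block2 P Q R S = (\<chi> i j. case i of
      Inl a \<Rightarrow> (case j of Inl b \<Rightarrow> P $ a $ b | Inr b \<Rightarrow> Q $ a $ b)
    | Inr a \<Rightarrow> (case j of Inl b \<Rightarrow> R $ a $ b | Inr b \<Rightarrow> S $ a $ b))"

definition real_rep :: "split_quat ^ 'n ^ 'm \<Rightarrow> real ^ ('n + 'n) ^ ('m + 'm)" where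
  "real_rep A = block2 (mat1 A + mat3 A) (- mat2 A + mat4 A) (mat2 A + mat4 A) (mat1 A - mat3 A)"

lemma bij_real_rep: "bij (real_rep :: split_quat ^ 'n ^ 'm \<Rightarrow> _)"
proof (rule o_bij)
  define g :: "real ^ ('n + 'n) ^ ('m + 'm) \<Rightarrow> split_quat ^ 'n ^ 'm" where
    "g M = (\<chi> i j. SQ ((M $ Inl i $ Inl j + M $ Inr i $ Inr j) / 2)
                      ((M $ Inr i $ Inl j - M $ Inl i $ Inr j) / 2)
                      ((M $ Inl i $ Inl j - M $ Inr i $ Inr j) / 2)
                      ((M $ Inr i $ Inl j + M $ Inl i $ Inr j) / 2))" for M
  note defs = g_def real_rep_def block2_def mat1_def mat2_def mat3_def mat4_def
  show "g \<circ> real_rep = id"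
    by (simp add: fun_eq_iff vec_eq_iff split_quat_eq_iff defs)
  show "real_rep \<circ> g = id"
    by (auto simp: fun_eq_iff vec_eq_iff defs field_simps split: sum.split)
qed

text \<open>The library norm on \<open>real ^ 'n ^ 'm\<close> is the real Frobenius norm.\<close>

definition fro_norm :: "split_quat ^ 'n ^ 'm \<Rightarrow> real" where
  "fro_norm A = sqrt ((norm (mat1 A))\<^sup>2 + (norm (mat2 A))\<^sup>2 + (norm (mat3 A))\<^sup>2 + (norm (mat4 A))\<^sup>2)"

lemma fro_norm_eq_norm: "fro_norm A = norm A"
proof -
  have "(norm (A $ i $ j))\<^sup>2 = (sq1 (A $ i $ j))\<^sup>2 + (sq2 (A $ i $ j))\<^sup>2 + (sq3 (A $ i $ j))\<^sup>2 + (sq4 (A $ i $ j))\<^sup>2"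
    for i j
    by (simp add: norm_split_quat_def inner_split_quat_def power2_eq_square)
  then show ?thesis
    by (simp add: fro_norm_def norm_vec_def L2_set_def mat1_def mat2_def mat3_def mat4_def
        real_sqrt_pow2 sum_nonneg sum.distrib)
qed

definition spectral_norm :: "real ^ 'n ^ 'm \<Rightarrow> real" where
  "spectral_norm M = onorm ((*v) M)"

definition sigma_norm :: "split_quat ^ 'n ^ 'm \<Rightarrow> real" where
  "sigma_norm A = spectral_norm (real_rep A)"

definition is_mp_inverse :: "real ^ 'n ^ 'm \<Rightarrow> real ^ 'm ^ 'n \<Rightarrow> bool" where
  "is_mp_inverse M X \<longleftrightarrow>
     M ** X ** M = M \<and> X ** M ** X = X \<and>
     transpose (M ** X) = M ** X \<and> transpose (X ** M) = X ** M"

definition mp_inverse :: "real ^ 'n ^ 'm \<Rightarrow> real ^ 'm ^ 'n" where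
  "mp_inverse M = (THE X. is_mp_inverse M X)"

definition sq_mp_inverse :: "split_quat ^ 'n ^ 'm \<Rightarrow> split_quat ^ 'm ^ 'n" where
  "sq_mp_inverse A = inv real_rep (mp_inverse (real_rep A))"

end

theory Submission
  imports Defs
begin

text \<open>
  Let \<open>P = M\<^sup>\<dagger>\<close>. Every iterate satisfies \<open>P M X\<^sub>k = X\<^sub>k = X\<^sub>k M P\<close>, so \<open>E\<^sub>k = X\<^sub>k - P\<close> obeys
  \<open>E\<^sub>k\<^sub>+\<^sub>1 = - E\<^sub>k M E\<^sub>k\<close>. Hence the residual \<open>G\<^sub>k = M (P - X\<^sub>k)\<close> is squared at each step, and
  \<open>E\<^sub>k = - P G\<^sub>k\<close>. The condition on \<open>\<alpha>\<close> makes \<open>G\<^sub>0 = M P - \<alpha> M M\<^sup>T\<close> a strict contraction,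
  which gives convergence. The factor \<open>\<surd>2\<close> comes from \<open>\<parallel>B\<^sup>\<sigma>\<parallel>\<^sub>F = \<surd>2 \<parallel>B\<parallel>\<^sub>F\<close>.
\<close>

section \<open>Bilinearity of the matrix product; spectral and Frobenius norm estimates\<close>

interpretation matmul: bounded_bilinear
  "(**) :: real ^ 'n ^ 'm \<Rightarrow> real ^ 'k ^ 'n \<Rightarrow> real ^ 'k ^ 'm"
  unfolding bilinear_conv_bounded_bilinear[symmetric] bilinear_def linear_iff
  by (simp add: matrix_matrix_mult_def vec_eq_iff sum.distrib sum_distrib_left algebra_simps)

lemma inner_transpose_mult:
  fixes A :: "real ^ 'n ^ 'm"
  shows "inner x (transpose A *v y) = inner (A *v x) y"
  by (metis dot_lmul_matrix inner_commute transpose_matrix_vector)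

lemma transpose_mult_self_eq_0:
  fixes D :: "real ^ 'n ^ 'm"
  assumes "transpose D ** D = 0"
  shows "D = 0"
proof -
  have "D *v x = 0" for x
  proof -
    have "inner (D *v x) (D *v x) = inner x ((transpose D ** D) *v x)"
      by (metis inner_transpose_mult matrix_vector_mul_assoc)
    then show ?thesis
      using assms by simp
  qed
  then show ?thesis
    by (simp add: matrix_eq)
qed

lemma norm_matrix_vector_le_spectral: "norm (A *v x) \<le> spectral_norm A * norm x"
  unfolding spectral_norm_def by (rule onorm[OF matrix_vector_mul_bounded_linear])

lemma spectral_norm_nonneg: "0 \<le> spectral_norm A"
  unfolding spectral_norm_def by (rule onorm_pos_le[OF matrix_vector_mul_bounded_linear])

lemma spectral_norm_pos:
  assumes "A \<noteq> 0"
  shows "0 < spectral_norm A"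
proof -
  have "(*v) A \<noteq> (\<lambda>x. 0)"
    using assms by (auto simp: matrix_eq fun_eq_iff)
  then show ?thesis
    unfolding spectral_norm_def
    by (metis onorm_pos_lt matrix_vector_mul_bounded_linear)
qed

lemma spectral_norm_matmul_le: "spectral_norm (A ** B) \<le> spectral_norm A * spectral_norm B"
proof -
  have "onorm ((*v) A \<circ> (*v) B) \<le> onorm ((*v) A) * onorm ((*v) B)"
    by (rule onorm_compose) (rule matrix_vector_mul_bounded_linear)+
  then show ?thesis
    by (simp add: spectral_norm_def o_def matrix_vector_mul_assoc)
qed

text \<open>For \<open>z = transpose A *v y\<close>, moving \<open>A\<close> across the inner
  product bounds the square of \<open>norm z\<close> by \<open>norm (A *v z) * norm y\<close>; one
  factor \<open>norm z\<close> then cancels.\<close>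

lemma norm_transpose_mult_le: "norm (transpose A *v y) \<le> spectral_norm A * norm y"
proof (cases "transpose A *v y = 0")
  case False
  define z where "z = transpose A *v y"
  have "norm z * norm z = inner (A *v z) y"
    by (metis inner_transpose_mult power2_norm_eq_inner power2_eq_square z_def)
  also have "\<dots> \<le> norm (A *v z) * norm y"
    by (rule norm_cauchy_schwarz)
  also have "\<dots> \<le> spectral_norm A * norm z * norm y"
    by (intro mult_right_mono norm_matrix_vector_le_spectral norm_ge_zero)
  finally have "norm z * norm z \<le> norm z * (spectral_norm A * norm y)"
    by (simp add: mult.assoc mult.left_commute)
  then show ?thesis
    using False unfolding z_def[symmetric] by simp
qed (simp add: spectral_norm_nonneg)

text \<open>Cauchy-Schwarz in each row.\<close>

lemma spectral_norm_le_norm: "spectral_norm A \<le> norm A"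
  unfolding spectral_norm_def
proof (rule onorm_le)
  fix x
  have "norm (A *v x) = L2_set (\<lambda>i. norm (inner (A $ i) x)) UNIV"
    by (simp add: norm_vec_def matrix_vector_mul_component)
  also have "\<dots> \<le> L2_set (\<lambda>i. norm (A $ i) * norm x) UNIV"
    by (intro L2_set_mono) (simp_all add: Cauchy_Schwarz_ineq2)
  also have "\<dots> = norm A * norm x"
    by (simp add: norm_vec_def L2_set_left_distrib)
  finally show "norm (A *v x) \<le> norm A * norm x" .
qed

text \<open>The rows of \<open>A ** B\<close> are the rows of \<open>A\<close> mapped by
  \<open>transpose B\<close>, so the bound for transposes applies row by row.\<close>

lemma norm_matmul_le_norm_spectral: "norm (A ** B) \<le> norm A * spectral_norm B"
proof -
  have row: "(A ** B) $ i = transpose B *v (A $ i)" for i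
    by (simp add: vec_eq_iff matrix_matrix_mult_def vector_matrix_mult_def mult.commute)
  have "norm (A ** B) = L2_set (\<lambda>i. norm (transpose B *v (A $ i))) UNIV"
    unfolding norm_vec_def[of "A ** B"] row ..
  also have "\<dots> \<le> L2_set (\<lambda>i. spectral_norm B * norm (A $ i)) UNIV"
    by (intro L2_set_mono norm_transpose_mult_le norm_ge_zero)
  also have "\<dots> = norm A * spectral_norm B"
    by (simp add: norm_vec_def L2_set_right_distrib[symmetric] spectral_norm_nonneg)
  finally show ?thesis .
qed

lemma norm_matmul_le: "norm (A ** B) \<le> norm A * norm (B :: real ^ 'k ^ 'n)"
  by (meson norm_matmul_le_norm_spectral spectral_norm_le_norm mult_left_mono norm_ge_zero
      order_trans)

section \<open>Existence and uniqueness of the Moore-Penrose inverse\<close>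

lemma ex_generalized_inverse:
  fixes S :: "real ^ 'n ^ 'm"
  obtains G where "S ** G ** S = S"
proof -
  obtain g where g: "linear g" "\<forall>v\<in>range ((*v) S). S *v g v = v"
    using linear_exists_right_inverse_on[of "(*v) S" UNIV] by auto
  have "S ** matrix g ** S = S"
    using g by (simp add: matrix_eq matrix_vector_mul_assoc[symmetric] matrix_works)
  then show ?thesis
    by (rule that)
qed

text \<open>Any generalized inverse \<open>G\<close> of \<open>M\<^sup>T M\<close> makes \<open>M G M\<^sup>T\<close> the orthogonal projection onto the range
  of \<open>M\<close>. With \<open>H\<close> obtained in the same way from \<open>M\<^sup>T\<close>, \<open>M\<^sup>\<dagger> = M\<^sup>T H M G M\<^sup>T\<close>.\<close>

lemma ex_range_projection:
  fixes M :: "real ^ 'n ^ 'm"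
  obtains G where "M ** G ** transpose M ** M = M"
    and "transpose (M ** G ** transpose M) = M ** G ** transpose M"
proof -
  obtain G where G: "transpose M ** M ** G ** (transpose M ** M) = transpose M ** M"
    by (rule ex_generalized_inverse)
  define Q where "Q = M ** G ** transpose M"
  define D where "D = Q ** M - M"
  have MD: "transpose M ** D = 0"
    using G by (simp add: D_def Q_def matmul.diff_right matrix_mul_assoc)
  \<comment> \<open>\<open>K\<close> exhibits \<open>D\<close> as \<open>M ** K\<close>, which puts
    the vanishing factor \<open>transpose M ** D\<close> into
    \<open>transpose D ** D\<close>.\<close>
  define K where "K = G ** transpose M ** M - mat 1"
  have "D = M ** K"
    by (simp add: D_def Q_def K_def matmul.diff_right matrix_mul_assoc)
  then have "transpose D = transpose K ** transpose M"
    by (simp only: matrix_transpose_mul)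
  then have "transpose D ** D = transpose K ** (transpose M ** D)"
    by (simp only: matrix_mul_assoc)
  also have "\<dots> = 0"
    by (simp add: MD)
  finally have "D = 0"
    by (rule transpose_mult_self_eq_0)
  then have QM: "Q ** M = M"
    by (simp add: D_def)
  \<comment> \<open>\<open>G\<close> need not be symmetric, so the symmetry of \<open>Q\<close> is
    derived from \<open>Q ** transpose Q = Q\<close>.\<close>
  then have "transpose M ** transpose Q = transpose M"
    by (simp only: matrix_transpose_mul[symmetric])
  moreover have "Q ** transpose Q = M ** G ** (transpose M ** transpose Q)"
    by (simp only: Q_def matrix_mul_assoc)
  ultimately have "Q ** transpose Q = Q"
    by (simp only: Q_def)
  moreover have "transpose (Q ** transpose Q) = Q ** transpose Q"
    by (simp only: matrix_transpose_mul transpose_transpose)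
  ultimately have "transpose Q = Q"
    by simp
  with QM show ?thesis
    unfolding Q_def by (rule that)
qed

lemma ex_mp_inverse:
  fixes M :: "real ^ 'n ^ 'm"
  obtains X where "is_mp_inverse M X"
proof -
  obtain G where G: "M ** G ** transpose M ** M = M"
      "transpose (M ** G ** transpose M) = M ** G ** transpose M"
    by (rule ex_range_projection)
  obtain H where H: "transpose M ** H ** M ** transpose M = transpose M"
      "transpose (transpose M ** H ** M) = transpose M ** H ** M"
    by (rule ex_range_projection[of "transpose M", unfolded transpose_transpose])
  define Q R where "Q = M ** G ** transpose M" and "R = transpose M ** H ** M"
  \<comment> \<open>This choice gives \<open>X ** M = R\<close> and \<open>M ** X = Q\<close>, which
    reduces the Penrose conditions to properties of the two projections.\<close>
  define X where "X = transpose M ** H ** Q"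
  have QM: "Q ** M = M" and Q: "transpose Q = Q"
    using G by (simp_all add: Q_def)
  have R: "transpose R = R" and RM: "R ** transpose M = transpose M"
    using H by (simp_all add: R_def)
  have "transpose (R ** transpose M) = M"
    by (simp only: RM transpose_transpose)
  then have MR: "M ** R = M"
    by (simp only: matrix_transpose_mul transpose_transpose R)
  have "X ** M = transpose M ** H ** (Q ** M)"
    by (simp only: X_def matrix_mul_assoc)
  then have XM: "X ** M = R"
    by (simp only: QM R_def)
  have "M ** X = M ** R ** (G ** transpose M)"
    by (simp only: X_def Q_def R_def matrix_mul_assoc)
  then have MX: "M ** X = Q"
    by (simp only: MR Q_def matrix_mul_assoc)
  have "R ** X = R ** transpose M ** (H ** Q)"
    by (simp only: X_def matrix_mul_assoc)
  then have "R ** X = X"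
    by (simp only: RM X_def matrix_mul_assoc)
  then have "is_mp_inverse M X"
    by (simp add: is_mp_inverse_def XM MX QM Q R)
  then show ?thesis
    by (rule that)
qed

text \<open>Transposing \<open>M ** Y ** (M ** X) = M ** X\<close> swaps the symmetric factors,
  whence \<open>M ** X = M ** Y\<close>; dually \<open>X ** M = Y ** M\<close>. Then
  \<open>X = X ** M ** X\<close> turns into \<open>Y ** M ** Y = Y\<close>.\<close>

lemma mp_inverse_unique:
  assumes X: "is_mp_inverse M X" and Y: "is_mp_inverse M Y"
  shows "X = Y"
proof -
  note defs = X[unfolded is_mp_inverse_def] Y[unfolded is_mp_inverse_def]
  have "M ** Y ** (M ** X) = M ** X"
    using defs by (simp add: matrix_mul_assoc)
  then have "transpose (M ** X) ** transpose (M ** Y) = transpose (M ** X)"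
    by (simp only: matrix_transpose_mul[symmetric])
  then have "M ** X ** (M ** Y) = M ** X"
    using defs by simp
  then have MX: "M ** X = M ** Y"
    using defs by (simp add: matrix_mul_assoc)
  have "X ** M ** (Y ** M) = X ** (M ** Y ** M)"
    by (simp only: matrix_mul_assoc)
  then have "X ** M ** (Y ** M) = X ** M"
    using defs by simp
  then have "transpose (Y ** M) ** transpose (X ** M) = transpose (X ** M)"
    by (simp only: matrix_transpose_mul[symmetric])
  then have "Y ** M ** (X ** M) = X ** M"
    using defs by simp
  moreover have "Y ** M ** (X ** M) = Y ** (M ** X ** M)"
    by (simp only: matrix_mul_assoc)
  ultimately have XM: "X ** M = Y ** M"
    using defs by simp
  have "X = X ** M ** X"
    using defs by simp
  also have "\<dots> = Y ** (M ** X)"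
    by (simp only: XM matrix_mul_assoc)
  also have "\<dots> = Y"
    using defs by (simp add: MX matrix_mul_assoc)
  finally show ?thesis .
qed

lemma is_mp_inverse_mp_inverse: "is_mp_inverse M (mp_inverse M)"
  unfolding mp_inverse_def by (metis ex_mp_inverse mp_inverse_unique theI)

text \<open>Both are transposes of \<open>M ** P ** M = M\<close>. They start the inductions on the
  iterates, since \<open>X 0\<close> is a multiple of \<open>transpose M\<close>.\<close>

lemma mp_inverse_matmul_transpose:
  assumes "is_mp_inverse M P"
  shows "P ** M ** transpose M = transpose M" and "transpose M ** M ** P = transpose M"
proof -
  have "M ** transpose (P ** M) = M" and "transpose (M ** P) ** M = M"
    using assms by (simp_all add: is_mp_inverse_def matrix_mul_assoc)
  then have "transpose (M ** transpose (P ** M)) = transpose M"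
    and "transpose (transpose (M ** P) ** M) = transpose M"
    by simp_all
  then show "P ** M ** transpose M = transpose M" and "transpose M ** M ** P = transpose M"
    unfolding matrix_transpose_mul[of M "transpose (P ** M)"]
      matrix_transpose_mul[of "transpose (M ** P)" M]
    by (simp_all add: matrix_mul_assoc)
qed

section \<open>Linearity and norm scaling of the real representation\<close>

lemma linear_real_rep: "linear real_rep"
  unfolding linear_iff real_rep_def block2_def mat1_def mat2_def mat3_def mat4_def
  by (auto simp: vec_eq_iff split_quat_defs scaleR_split_quat_def algebra_simps split: sum.split)

text \<open>For an entry with coefficients a, b, c, d, the four block entries pair up by the
  parallelogram identity: (a+c)^2 + (a-c)^2 = 2(a^2+c^2), and likewise for b and d.\<close>

lemma norm_real_rep: "norm (real_rep A) = sqrt 2 * norm A"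
proof -
  have sq: "(norm B)\<^sup>2 = (\<Sum>i\<in>UNIV. \<Sum>j\<in>UNIV. (norm (B $ i $ j))\<^sup>2)"
    for B :: "'v::real_normed_vector ^ 'k ^ 'l"
    by (simp add: norm_vec_def L2_set_def sum_nonneg)
  have sum_UNIV_Plus: "(\<Sum>i\<in>UNIV. f i) = (\<Sum>i\<in>UNIV. f (Inl i) + f (Inr i))"
    for f :: "'k::finite + 'k \<Rightarrow> real"
    by (simp add: UNIV_Plus_UNIV[symmetric] sum.Plus sum.distrib del: UNIV_Plus_UNIV)
  have "(norm (real_rep A))\<^sup>2 = 2 * (norm A)\<^sup>2"
    unfolding sq sum_UNIV_Plus sum_distrib_left sum.distrib[symmetric]
    by (intro sum.cong refl)
      (simp add: real_rep_def block2_def mat1_def mat2_def mat3_def mat4_def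
        norm_split_quat_def inner_split_quat_def power2_eq_square algebra_simps)
  then have "(norm (real_rep A))\<^sup>2 = (sqrt 2 * norm A)\<^sup>2"
    by (simp add: power_mult_distrib)
  then show ?thesis
    by (rule power2_eq_imp_eq) simp_all
qed

section \<open>Contraction by the initial residual\<close>

text \<open>Only the projection \<open>u\<close> of \<open>x\<close> onto the range of
  \<open>M\<close> matters. Expanding the square of \<open>norm (u - \<alpha> *\<^sub>R v)\<close>,
  the bound on \<open>\<alpha>\<close> makes the cross term outweigh the quadratic one.\<close>

lemma spectral_norm_projection_diff_less_1:
  fixes M :: "real ^ 'n ^ 'm"
  assumes P: "is_mp_inverse M P" and alpha: "0 < \<alpha>" "\<alpha> * (spectral_norm M)\<^sup>2 < 2"
  shows "spectral_norm (M ** P - \<alpha> *\<^sub>R (M ** transpose M)) < 1"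
proof -
  define F where "F = M ** P - \<alpha> *\<^sub>R (M ** transpose M)"
  have "norm (F *v x) < norm x" if "x \<noteq> 0" for x
  proof -
    define u v where "u = (M ** P) *v x" and "v = M *v (transpose M *v u)"
    have u: "(M ** P) *v u = u"
      using P by (simp add: u_def is_mp_inverse_def matrix_vector_mul_assoc matrix_mul_assoc)
    have Mu: "transpose M *v u = transpose M *v x"
      using mp_inverse_matmul_transpose(2)[OF P]
      by (simp add: u_def matrix_vector_mul_assoc matrix_mul_assoc
          del: transpose_matrix_vector)
    have Fx: "F *v x = u - \<alpha> *\<^sub>R v"
      unfolding F_def v_def Mu
      by (simp add: u_def matrix_vector_mult_diff_rdistrib scaleR_matrix_vector_assoc[symmetric]
          matrix_vector_mul_assoc[symmetric])
    have "inner u u = inner u x"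
      using P u unfolding is_mp_inverse_def by (metis inner_transpose_mult u_def)
    then have "norm u * norm u \<le> norm u * norm x"
      by (metis norm_cauchy_schwarz power2_norm_eq_inner power2_eq_square)
    then have ux: "norm u \<le> norm x"
      by (cases "u = 0") simp_all
    show ?thesis
    proof (cases "transpose M *v u = 0")
      case True
      \<comment> \<open>Since \<open>M ** P\<close> is symmetric and fixes \<open>u\<close>, the
        left-hand side is \<open>u\<close> itself.\<close>
      then have "(transpose P ** transpose M) *v u = 0"
        by (metis matrix_vector_mul_assoc matrix_vector_mult_0_right)
      then have "u = 0"
        using P u unfolding is_mp_inverse_def by (metis matrix_transpose_mul)
      then show ?thesis
        using that Fx by (simp add: v_def)
    next
      case False
      have "(norm v)\<^sup>2 \<le> (spectral_norm M)\<^sup>2 * (norm (transpose M *v u))\<^sup>2"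
        unfolding v_def power_mult_distrib[symmetric]
        by (intro power_mono norm_matrix_vector_le_spectral norm_ge_zero)
      then have "\<alpha>\<^sup>2 * (norm v)\<^sup>2 \<le> \<alpha>\<^sup>2 * ((spectral_norm M)\<^sup>2 * (norm (transpose M *v u))\<^sup>2)"
        by (rule mult_left_mono) simp
      also have "\<dots> = \<alpha> * (norm (transpose M *v u))\<^sup>2 * (\<alpha> * (spectral_norm M)\<^sup>2)"
        by (simp add: power2_eq_square)
      also have "\<dots> < \<alpha> * (norm (transpose M *v u))\<^sup>2 * 2"
        using alpha False by (intro mult_strict_left_mono) simp_all
      finally have less: "\<alpha>\<^sup>2 * (norm v)\<^sup>2 < 2 * \<alpha> * (norm (transpose M *v u))\<^sup>2"
        by simp
      have "inner u v = (norm (transpose M *v u))\<^sup>2"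
        unfolding v_def inner_transpose_mult[of _ "transpose M", simplified transpose_transpose] by (simp add: power2_norm_eq_inner)
      moreover have "(norm (u - \<alpha> *\<^sub>R v))\<^sup>2 = (norm u)\<^sup>2 - 2 * \<alpha> * inner u v + \<alpha>\<^sup>2 * (norm v)\<^sup>2"
        unfolding power2_norm_eq_inner
        by (simp add: inner_diff inner_commute[of v u] power2_eq_square algebra_simps)
      ultimately have "(norm (F *v x))\<^sup>2
          = (norm u)\<^sup>2 - 2 * \<alpha> * (norm (transpose M *v u))\<^sup>2 + \<alpha>\<^sup>2 * (norm v)\<^sup>2"
        unfolding Fx by simp
      then have "(norm (F *v x))\<^sup>2 < (norm u)\<^sup>2"
        using less by simp
      then show ?thesis
        using ux by (meson norm_ge_zero order_less_le_trans power_less_imp_less_base)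
    qed
  qed
  note contr = this
  \<comment> \<open>Compactness of the sphere provides a maximiser \<open>y\<close>, so the strict
    pointwise inequality yields a norm strictly below 1.\<close>
  have "continuous_on (sphere 0 1) (\<lambda>x. norm (F *v x))"
    by (intro continuous_intros)
  then have "\<exists>y\<in>sphere 0 1. \<forall>x\<in>sphere 0 1. norm (F *v x) \<le> norm (F *v y)"
    by (intro continuous_attains_sup) simp_all
  then obtain y where y: "y \<in> sphere 0 1" "\<And>x. x \<in> sphere 0 1 \<Longrightarrow> norm (F *v x) \<le> norm (F *v y)"
    by blast
  have "norm (F *v x) \<le> norm (F *v y) * norm x" for x
  proof (cases "x = 0")
    case False
    then have "norm (F *v sgn x) \<le> norm (F *v y)"
      by (intro y) (simp add: norm_sgn)
    then show ?thesis
      using False by (simp add: sgn_div_norm matrix_vector_mult_scaleR divide_inverse[symmetric]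
          field_simps)
  qed simp
  then have "spectral_norm F \<le> norm (F *v y)"
    unfolding spectral_norm_def by (rule onorm_le)
  also have "\<dots> < 1"
    using contr[of y] y(1) by (cases "y = 0") auto
  finally show ?thesis
    unfolding F_def .
qed

section \<open>The Newton-Schulz iteration for real matrices\<close>

locale newton_schulz =
  fixes M :: "real ^ 'n ^ 'm" and P :: "real ^ 'm ^ 'n" and \<alpha> :: real
    and X :: "nat \<Rightarrow> real ^ 'm ^ 'n"
  assumes P: "is_mp_inverse M P"
    and X_0: "X 0 = \<alpha> *\<^sub>R transpose M"
    and X_Suc: "\<And>k. X (Suc k) = X k ** (2 *\<^sub>R mat 1 - M ** X k)"
begin

lemma X_Suc_right: "X (Suc k) = 2 *\<^sub>R X k - X k ** M ** X k"
  by (simp add: X_Suc matmul.diff_right matmul.scaleR_right matrix_mul_assoc)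

text \<open>With \<open>X k\<close> as the last factor, a projection on the right can be absorbed in
  \<open>X_projection\<close>.\<close>

lemma X_Suc_left: "X (Suc k) = (2 *\<^sub>R mat 1 - X k ** M) ** X k"
  by (simp add: X_Suc_right matmul.diff_left matmul.scaleR_left)

lemma projection_X: "P ** M ** X k = X k"
proof (induction k)
  case 0
  show ?case
    using mp_inverse_matmul_transpose[OF P] by (simp add: X_0 matmul.scaleR_right)
next
  case (Suc k)
  then show ?case
    by (simp add: X_Suc matrix_mul_assoc)
qed

lemma X_projection: "X k ** M ** P = X k"
proof (induction k)
  case 0
  show ?case
    using mp_inverse_matmul_transpose[OF P] by (simp add: X_0 matmul.scaleR_left)
next
  case (Suc k)
  have "X (Suc k) ** M ** P = (2 *\<^sub>R mat 1 - X k ** M) ** (X k ** M ** P)"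
    by (simp only: X_Suc_left matrix_mul_assoc)
  then show ?case
    by (simp only: Suc X_Suc_left)
qed

text \<open>In the expanded product both cross terms collapse to \<open>X k\<close> and
  \<open>P ** M ** P\<close> to \<open>P\<close>.\<close>

lemma error_Suc: "X (Suc k) - P = - ((X k - P) ** M ** (X k - P))"
  using P projection_X[of k] X_projection[of k]
  by (simp add: X_Suc_right is_mp_inverse_def matmul.diff_left matmul.diff_right scaleR_2)

lemma norm_error_Suc_le: "norm (X (Suc k) - P) \<le> spectral_norm M * (norm (X k - P))\<^sup>2"
proof -
  have "norm (X (Suc k) - P) \<le> norm ((X k - P) ** M) * norm (X k - P)"
    unfolding error_Suc norm_minus_cancel by (rule norm_matmul_le)
  also have "\<dots> \<le> norm (X k - P) * spectral_norm M * norm (X k - P)"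
    by (intro mult_right_mono norm_matmul_le_norm_spectral norm_ge_zero)
  finally show ?thesis
    by (simp add: power2_eq_square mult_ac)
qed

lemma spectral_norm_residual_le:
  "spectral_norm (M ** (P - X k)) \<le> spectral_norm (M ** (P - X 0)) ^ (2 ^ k)"
proof (induction k)
  case (Suc k)
  have "P - X (Suc k) = (P - X k) ** M ** (P - X k)"
    using error_Suc[of k] by (simp add: matmul.diff_left matmul.diff_right algebra_simps)
  then have "M ** (P - X (Suc k)) = (M ** (P - X k)) ** (M ** (P - X k))"
    by (simp add: matrix_mul_assoc)
  then have "spectral_norm (M ** (P - X (Suc k))) \<le> (spectral_norm (M ** (P - X k)))\<^sup>2"
    using spectral_norm_matmul_le by (metis power2_eq_square)
  also have "\<dots> \<le> (spectral_norm (M ** (P - X 0)) ^ (2 ^ k))\<^sup>2"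
    by (intro power_mono Suc.IH spectral_norm_nonneg)
  finally show ?case
    by (simp add: power_mult[symmetric] mult.commute)
qed simp

text \<open>\<open>P ** M\<close> fixes \<open>P - X k\<close>, so the error is \<open>P\<close>
  times the residual, up to sign.\<close>

lemma norm_error_le:
  "norm (X k - P) \<le> norm P * spectral_norm (M ** (P - X 0)) ^ (2 ^ k)"
proof -
  have "P ** (M ** (P - X k)) = P - X k"
    using P projection_X[of k] by (simp add: is_mp_inverse_def matmul.diff_right matrix_mul_assoc)
  then have "norm (P - X k) \<le> norm P * spectral_norm (M ** (P - X k))"
    using norm_matmul_le_norm_spectral[of P "M ** (P - X k)"] by simp
  also have "\<dots> \<le> norm P * spectral_norm (M ** (P - X 0)) ^ (2 ^ k)"
    by (intro mult_left_mono spectral_norm_residual_le norm_ge_zero)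
  finally show ?thesis
    by (simp add: norm_minus_commute)
qed

lemma tendsto_mp_inverse:
  assumes alpha: "0 < \<alpha>" "\<alpha> * (spectral_norm M)\<^sup>2 < 2"
  shows "X \<longlonglongrightarrow> P"
proof -
  define c where "c = spectral_norm (M ** (P - X 0))"
  have c: "0 \<le> c" "c < 1"
    using spectral_norm_projection_diff_less_1[OF P alpha]
    by (simp_all add: c_def spectral_norm_nonneg X_0 matmul.diff_right matmul.scaleR_right)
  \<comment> \<open>The powers with exponents \<open>2 ^ k\<close> form a subsequence of the
    geometric sequence.\<close>
  have "strict_mono (\<lambda>k. 2 ^ k :: nat)"
    by (simp add: strict_mono_def)
  then have "(\<lambda>k. c ^ (2 ^ k)) \<longlonglongrightarrow> 0"
    using LIMSEQ_subseq_LIMSEQ[OF LIMSEQ_realpow_zero[OF c]] by (simp add: o_def)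
  then have "(\<lambda>k. norm P * c ^ (2 ^ k)) \<longlonglongrightarrow> 0"
    by (rule tendsto_mult_right_zero)
  then have "(\<lambda>k. X k - P) \<longlonglongrightarrow> 0"
    by (rule Lim_null_comparison[rotated]) (simp add: c_def norm_error_le)
  then show ?thesis
    by (simp add: LIM_zero_iff)
qed

end

section \<open>Transfer to split quaternions\<close>

theorem theorem4p6:
  fixes A :: "split_quat ^ 'n ^ 'm"
    and M :: "real ^ ('n + 'n) ^ ('m + 'm)"
    and \<alpha> :: real
    and X :: "nat \<Rightarrow> real ^ ('m + 'm) ^ ('n + 'n)"
    and Xhat Ehat :: "nat \<Rightarrow> split_quat ^ 'm ^ 'n"
  assumes M: "M = real_rep A" "M \<noteq> 0"
    and alpha: "0 < \<alpha>" "\<alpha> < 2 / (spectral_norm M)\<^sup>2"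
    and X_0: "X 0 = \<alpha> *\<^sub>R transpose M"
    and X_Suc: "\<And>k. X (Suc k) = X k ** (2 *\<^sub>R mat 1 - M ** X k)"
    and Xhat: "\<And>k. Xhat k = inv real_rep (X k)"
    and Ehat: "\<And>k. Ehat k = Xhat k - sq_mp_inverse A"
  shows "(\<forall>k. X (Suc k) = (2 *\<^sub>R mat 1 - X k ** M) ** X k) \<and>
         Xhat \<longlonglongrightarrow> sq_mp_inverse A \<and>
         (\<forall>k. fro_norm (Ehat (Suc k)) \<le> sqrt 2 * sigma_norm A * (fro_norm (Ehat k))\<^sup>2)"
proof -
  define P where "P = mp_inverse M"
  interpret newton_schulz M P \<alpha> X
    by unfold_locales (simp_all add: P_def is_mp_inverse_mp_inverse X_0 X_Suc)
  have "real_rep (Ehat k) = X k - P" for k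
    unfolding Ehat Xhat sq_mp_inverse_def P_def M(1)[symmetric] linear_diff[OF linear_real_rep]
    by (simp add: surj_f_inv_f bij_is_surj bij_real_rep)
  then have norm_E: "norm (X k - P) = sqrt 2 * norm (Ehat k)" for k
    by (metis norm_real_rep)
  \<comment> \<open>\<open>M \<noteq> 0\<close> gives a positive spectral norm, which allows
    clearing the denominator in the bound on \<open>\<alpha>\<close>.\<close>
  have "X \<longlonglongrightarrow> P"
    using alpha M(2) spectral_norm_pos[of M] by (intro tendsto_mp_inverse) (simp_all add: field_simps)
  then have "(\<lambda>k. norm (X k - P) / sqrt 2) \<longlonglongrightarrow> 0 / sqrt 2"
    by (intro tendsto_divide tendsto_const tendsto_norm_zero LIM_zero) simp_all
  then have "Ehat \<longlonglongrightarrow> 0"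
    by (simp add: norm_E tendsto_norm_zero_iff)
  then have "Xhat \<longlonglongrightarrow> sq_mp_inverse A"
    by (simp add: Ehat[abs_def] LIM_zero_iff)
  moreover have "norm (Ehat (Suc k)) \<le> sqrt 2 * sigma_norm A * (norm (Ehat k))\<^sup>2" for k
  proof -
    \<comment> \<open>The real estimate carries one factor \<open>sqrt 2\<close> on the left and two
      on the right; cancelling leaves the stated constant.\<close>
    have "sqrt 2 * norm (Ehat (Suc k)) \<le> spectral_norm M * (sqrt 2 * norm (Ehat k))\<^sup>2"
      using norm_error_Suc_le[of k] by (simp only: norm_E)
    also have "\<dots> = sqrt 2 * (sqrt 2 * sigma_norm A * (norm (Ehat k))\<^sup>2)"
      by (simp add: sigma_norm_def M(1) power_mult_distrib)
    finally show ?thesis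
      by simp
  qed
  ultimately show ?thesis
    using X_Suc_left by (simp add: fro_norm_eq_norm)
qed

end
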